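(* Let $q\in\mathbb{C}$ with $0<|q|<1$, let $n\ge 0$ be an integer and let $k$ be an integer with $0\le k\le\frac{n+1}{2}$. Then the incomplete $q$-Chebyshev polynomials of the first and second kind are related by $$\mathcal{T}_{n+2}^{k}=x\,\mathcal{U}_{n+1}^{k}+q^{n+1}s\,\mathcal{U}_{n}^{k-1},$$ where $\mathcal{T}_m^k=\mathcal{T}_m^k(x,s,q)$ and $\mathcal{U}_m^k=\mathcal{U}_m^k(x,s,q)$.
   Context: Notation: $[n]_q=\frac{1-q^n}{1-q}$, $[0]_q=0$; $(a;q)_0=1$ and $(a;q)_n=\prod_{i=0}^{n-1}(1-q^i a)$; $\begin{bmatrix} n\\k\end{bmatrix}_q=\frac{(q;q)_n}{(q;q)_{n-k}(q;q)_k}$ for $0\le k\le n$, and it is $0$ for $n<k$. Here $x,s$ are indeterminates. For a nonnegative integer $n$ and $0\le k\le\lfloor n/2\rfloor$, the incomplete $q$-Chebyshev polynomials of the second kind are $$\mathcal{U}_n^k(x,s,q)=\sum_{j=0}^{k}q^{j^2}\begin{bmatrix} n-j\\ j\end{bmatrix}_q\frac{(-q;q)_{n-j}}{(-q;q)_j}\,s^jx^{n-2j},$$ with $\mathcal{U}_n^{-1}=0$ (empty sum). For $n\ge1$ and $0\le k\le\lfloor n/2\rfloor$, the incomplete $q$-Chebyshev polynomials of the first kind are $$\mathcal{T}_n^k(x,s,q)=\sum_{j=0}^{k}q^{j^2}\frac{[n]_q}{[n-j]_q}\begin{bmatrix} n-j\\ j\end{bmatrix}_q\frac{(-q;q)_{n-j-1}}{(-q;q)_j}\,s^jx^{n-2j}.$$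 *)

theory Defs
  imports Complex_Main "HOL-Computational_Algebra.Polynomial"
begin

definition q_bracket :: "nat \<Rightarrow> complex \<Rightarrow> complex" where
  "q_bracket n q = (1 - q ^ n) / (1 - q)"

definition q_poch :: "complex \<Rightarrow> complex \<Rightarrow> nat \<Rightarrow> complex" where
  "q_poch a q n = (\<Prod>i<n. 1 - q ^ i * a)"

definition q_binom :: "nat \<Rightarrow> nat \<Rightarrow> complex \<Rightarrow> complex" where
  "q_binom n k q =
     (if k \<le> n then q_poch q q n / (q_poch q q (n - k) * q_poch q q k) else 0)"

text \<open>The polynomial ring \<open>\<complex>[s][x]\<close>: the indeterminate \<open>x\<close> is the outer variable
  and \<open>s\<close> is the variable of the coefficient ring.\<close>

definition var_x :: "complex poly poly" where
  "var_x = [:0, 1:]"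

definition var_s :: "complex poly poly" where
  "var_s = [:[:0, 1:]:]"

definition scal :: "complex \<Rightarrow> complex poly poly" where
  "scal c = [:[:c:]:]"

text \<open>The upper summation limit \<open>k\<close> is an integer, so that \<open>k = -1\<close> gives the empty sum.
  The truncated subtractions below are exact on the intended domain \<open>-1 \<le> k \<le> \<lfloor>n/2\<rfloor>\<close>
  (for the first kind also \<open>n \<ge> 1\<close>); values outside it are irrelevant.\<close>

definition inc_cheb_U :: "nat \<Rightarrow> int \<Rightarrow> complex \<Rightarrow> complex poly poly" where
  "inc_cheb_U n k q =
     (\<Sum>j | int j \<le> k.
        scal (q ^ (j ^ 2) * q_binom (n - j) j q
              * (q_poch (- q) q (n - j) / q_poch (- q) q j))
        * var_s ^ j * var_x ^ (n - 2 * j))"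

definition inc_cheb_T :: "nat \<Rightarrow> int \<Rightarrow> complex \<Rightarrow> complex poly poly" where
  "inc_cheb_T n k q =
     (\<Sum>j | int j \<le> k.
        scal (q ^ (j ^ 2) * (q_bracket n q / q_bracket (n - j) q) * q_binom (n - j) j q
              * (q_poch (- q) q (n - j - 1) / q_poch (- q) q j))
        * var_s ^ j * var_x ^ (n - 2 * j))"

end

theory Submission imports Defs
begin

text \<open>
  Both sides are compared coefficientwise. At index \<open>0\<close> only the first summand on the right
  contributes, and both \<open>q\<close>-binomial coefficients are \<open>1\<close>. For a positive index \<open>j\<close>, write \<open>N = n + 2\<close>; after the
  common factor \<open>q ^ (j\<^sup>2) (-q;q)\<^bsub>N-1-j\<^esub> / (-q;q)\<^sub>j\<close> has been divided out, the coefficient of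
  \<open>s ^ j x ^ (N - 2 j)\<close> in the claim reads, with \<open>[a; b]\<close> for the \<open>q\<close>-binomial coefficient,
  \[ \frac{[N]_q}{[N-j]_q} [N-j; j] = [N-1-j; j] + q^{N-2j} (1 + q^j) [N-1-j; j-1] . \]
  The \<open>q\<close>-binomial coefficients \<open>[N-j; j]\<close> and \<open>[N-1-j; j]\<close> are the multiples of \<open>[N-1-j; j-1]\<close> by
  \<open>(1 - q^{N-j}) / (1 - q^j)\<close> and \<open>(1 - q^{N-2j}) / (1 - q^j)\<close>, so everything comes down to
  \<open>1 - q^N = (1 - q^{N-2j}) + q^{N-2j} (1 - q^{2j})\<close>; this is \<open>q_lucas_recurrence\<close>. The factor
  \<open>1 + q^j\<close> and the exponent \<open>N - 2j\<close> arise because in the second summand of the claim the index is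
  shifted by one: \<open>(-q;q)\<^sub>j = (-q;q)\<^bsub>j-1\<^esub> (1 + q^j)\<close> and \<open>n + 1 + (j-1)\<^sup>2 = j\<^sup>2 + (N - 2j)\<close>.
  The hypothesis \<open>norm q < 1\<close> guarantees that no denominator vanishes, and the bound on \<open>k\<close> ensures
  \<open>2 j < N\<close> throughout, so that the exponents of \<open>x\<close> on the two sides agree.
\<close>

lemma scal_mult: "scal a * scal b = scal (a * b)"
  by (simp add: scal_def)

lemma scal_add: "scal a + scal b = scal (a + b)"
  by (simp add: scal_def)

lemma power_neq_of_norm_less_1:
  fixes q c :: complex
  assumes "norm q < 1" "norm c = 1" "0 < m"
  shows "q ^ m \<noteq> c"
proof
  assume "q ^ m = c"
  then have "norm q ^ m = 1"
    using assms(2) by (metis norm_power)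
  moreover have "norm q ^ m < 1"
    using assms(1,3) by (simp add: power_less_one_iff)
  ultimately show False by simp
qed

lemma q_poch_0 [simp]: "q_poch a q 0 = 1"
  by (simp add: q_poch_def)

lemma q_poch_Suc: "q_poch a q (Suc n) = q_poch a q n * (1 - q ^ n * a)"
  by (simp add: q_poch_def)

lemma q_poch_nonzero:
  assumes "norm q < 1"
  shows "q_poch q q n \<noteq> 0" and "q_poch (- q) q n \<noteq> 0"
proof -
  have "1 - q ^ Suc i \<noteq> 0" and "1 + q ^ Suc i \<noteq> 0" for i
    using power_neq_of_norm_less_1[OF assms, of 1 "Suc i"]
      power_neq_of_norm_less_1[OF assms, of "-1" "Suc i"]
    by (auto simp: add_eq_0_iff)
  then show "q_poch q q n \<noteq> 0" and "q_poch (- q) q n \<noteq> 0"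
    by (auto simp: q_poch_def mult.commute)
qed

lemma q_binom_0 [simp]:
  assumes "norm q < 1"
  shows "q_binom n 0 q = 1"
  using q_poch_nonzero[OF assms] by (simp add: q_binom_def)

lemma q_bracket_nonzero:
  assumes "norm q < 1" "0 < n"
  shows "q_bracket n q \<noteq> 0"
  using power_neq_of_norm_less_1[of q 1 n] assms by (auto simp: q_bracket_def)

text \<open>A \<open>q\<close>-analogue of the expression of Lucas polynomial coefficients by binomial coefficients.
  The index is \<open>j = i + 1\<close>, and \<open>m = N - 2 j - 1\<close> measures the distance to the boundary \<open>2 j < N\<close>.\<close>

lemma q_lucas_recurrence:
  assumes "norm q < 1"
  shows "q_bracket (m + 2 * i + 3) q / q_bracket (m + i + 2) q * q_binom (m + i + 2) (Suc i) q
       = q_binom (m + i + 1) (Suc i) q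
         + q ^ (m + 1) * (1 + q ^ Suc i) * q_binom (m + i + 1) i q"
proof -
  define P where "P = q_poch q q"
  have P_Suc: "P (Suc a) = P a * (1 - q ^ Suc a)" for a
    by (simp add: P_def q_poch_Suc mult.commute)
  have nz: "1 - q ^ Suc a \<noteq> 0" "P a \<noteq> 0" for a
    using power_neq_of_norm_less_1[OF assms, of 1 "Suc a"] q_poch_nonzero[OF assms]
    by (auto simp: P_def)
  have q1: "1 - q \<noteq> 0"
    using nz(1)[of 0] by simp
  define B where "B = q_binom (m + i + 1) i q"
  have B: "B = P (m + i + 1) / (P (Suc m) * P i)"
    by (simp add: B_def q_binom_def P_def)
  have upper: "q_binom (m + i + 2) (Suc i) q = (1 - q ^ (m + i + 2)) / (1 - q ^ Suc i) * B"
    using P_Suc[of "m + i + 1"] P_Suc[of i] by (simp add: B q_binom_def mult_ac flip: P_def)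
  have lower: "q_binom (m + i + 1) (Suc i) q = (1 - q ^ Suc m) / (1 - q ^ Suc i) * B"
    using nz(1)[of m] P_Suc[of i] by (simp add: B P_Suc[of m] q_binom_def mult_ac flip: P_def)
  have "1 - q ^ (m + i + 2) \<noteq> 0"
    using nz(1)[of "m + i + 1"] by simp
  then have "q_bracket (m + 2 * i + 3) q / q_bracket (m + i + 2) q
               * q_binom (m + i + 2) (Suc i) q
             = (1 - q ^ (m + 2 * i + 3)) / (1 - q ^ Suc i) * B"
    unfolding q_bracket_def upper using q1 by (simp add: divide_simps)
  also have "q ^ (m + 2 * i + 3) = q ^ (m + 1) * (q ^ Suc i * q ^ Suc i)"
  proof -
    have "m + 2 * i + 3 = (m + 1) + (Suc i + Suc i)" by simp
    then show ?thesis by (simp only: power_add)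
  qed
  also have "1 - q ^ (m + 1) * (q ^ Suc i * q ^ Suc i)
             = (1 - q ^ Suc m) + q ^ (m + 1) * (1 + q ^ Suc i) * (1 - q ^ Suc i)"
    by (simp add: algebra_simps)
  also have "\<dots> / (1 - q ^ Suc i) * B
             = q_binom (m + i + 1) (Suc i) q + q ^ (m + 1) * (1 + q ^ Suc i) * B"
    unfolding lower add_divide_distrib distrib_right using nz(1)[of i] by simp
  finally show ?thesis
    by (simp add: B_def)
qed

theorem theorem4:
  fixes q :: complex and n :: nat and k :: int
  assumes "0 < norm q" and "norm q < 1"
    and "0 \<le> k" and "real_of_int k \<le> (real n + 1) / 2"
  shows "inc_cheb_T (n + 2) k q =
           var_x * inc_cheb_U (n + 1) k q + scal (q ^ (n + 1)) * var_s * inc_cheb_U n (k - 1) q"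
proof -
  obtain K where k: "k = int K"
    using assms(3) nonneg_int_cases by blast
  have K: "2 * K \<le> n + 1"
    using assms(4) k by simp
  have ranges: "{j. int j \<le> k} = {..K}" "{j. int j \<le> k - 1} = {..<K}"
    using k by auto
  define tc where "tc j = q ^ (j ^ 2) * (q_bracket (n + 2) q / q_bracket (n + 2 - j) q)
    * q_binom (n + 2 - j) j q * (q_poch (- q) q (n + 2 - j - 1) / q_poch (- q) q j)" for j
  define uc where "uc N j = q ^ (j ^ 2) * q_binom (N - j) j q
    * (q_poch (- q) q (N - j) / q_poch (- q) q j)" for N j
  have coeff_0: "tc 0 = uc (n + 1) 0"
    using q_bracket_nonzero[OF assms(2), of "n + 2"] assms(2) by (simp add: tc_def uc_def)
  have coeff_Suc: "tc (Suc i) = uc (n + 1) (Suc i) + q ^ (n + 1) * uc n i" if "i < K" for i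
  proof -
    have "2 * Suc i \<le> n + 1"
      using that K by simp
    then obtain m where "n + 1 = 2 * Suc i + m"
      using le_Suc_ex by blast
    then have n: "n = m + 2 * i + 1" by simp
    define R where "R = q_poch (- q) q (m + i + 1)"
    define r where "r = q_poch (- q) q i"
    define w where "w = 1 + q ^ Suc i"
    have r_Suc: "q_poch (- q) q (Suc i) = r * w"
      by (simp add: r_def w_def q_poch_Suc mult.commute)
    have "r * w \<noteq> 0"
      using q_poch_nonzero(2)[OF assms(2), of "Suc i"] r_Suc by simp
    then have nz: "r \<noteq> 0" "w \<noteq> 0" by auto
    have expo: "q ^ (n + 1) * q ^ (i ^ 2) = q ^ (Suc i ^ 2) * q ^ (m + 1)"
      by (simp add: n power2_eq_square mult_2 add_ac flip: power_add)
    have sub: "n + 2 - Suc i - 1 = m + i + 1" "n + 2 - Suc i = m + i + 2" "n + 2 = m + 2 * i + 3"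
      "n + 1 - Suc i = m + i + 1" "n - i = m + i + 1"
      by (simp_all add: n)
    \<comment> \<open>The left-hand sides of the index equations are nested, so the largest is rewritten first.\<close>
    have "tc (Suc i) = q ^ (Suc i ^ 2) * (R / (r * w))
        * (q_bracket (m + 2 * i + 3) q / q_bracket (m + i + 2) q * q_binom (m + i + 2) (Suc i) q)"
      unfolding tc_def unfolding sub(1) unfolding sub(2) unfolding sub(3) r_Suc R_def
      by (simp only: mult_ac)
    also have "\<dots> = q ^ (Suc i ^ 2) * q_binom (m + i + 1) (Suc i) q * (R / (r * w))
        + q ^ (Suc i ^ 2) * q ^ (m + 1) * q_binom (m + i + 1) i q * (R / r)"
      unfolding q_lucas_recurrence[OF assms(2)] w_def[symmetric]
      using nz by (simp add: field_simps)
    also have "\<dots> = uc (n + 1) (Suc i) + q ^ (n + 1) * uc n i"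
      unfolding uc_def sub r_Suc R_def[symmetric] r_def[symmetric] expo[symmetric]
      by (simp only: mult_ac)
    finally show ?thesis .
  qed
  have term_0: "scal (tc 0) * var_s ^ 0 * var_x ^ (n + 2 - 2 * 0)
      = var_x * (scal (uc (n + 1) 0) * var_s ^ 0 * var_x ^ (n + 1 - 2 * 0))"
    by (simp add: coeff_0 mult_ac)
  have term_Suc: "scal (tc (Suc i)) * var_s ^ Suc i * var_x ^ (n + 2 - 2 * Suc i)
      = var_x * (scal (uc (n + 1) (Suc i)) * var_s ^ Suc i * var_x ^ (n + 1 - 2 * Suc i))
        + scal (q ^ (n + 1)) * var_s * (scal (uc n i) * var_s ^ i * var_x ^ (n - 2 * i))"
    if "i < K" for i
  proof -
    \<comment> \<open>Truncated subtraction is exact here because \<open>2 * Suc i \<le> n + 1\<close>.\<close>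
    have x1: "n + 2 - 2 * Suc i = Suc (n + 1 - 2 * Suc i)"
      and x2: "n - 2 * i = Suc (n + 1 - 2 * Suc i)"
      using that K by simp_all
    show ?thesis
      unfolding x1 x2 coeff_Suc[OF that] scal_add[symmetric] scal_mult[symmetric] power_Suc
      by (simp only: distrib_left distrib_right mult_ac)
  qed
  have "inc_cheb_T (n + 2) k q = (\<Sum>j\<le>K. scal (tc j) * var_s ^ j * var_x ^ (n + 2 - 2 * j))"
    unfolding inc_cheb_T_def ranges tc_def ..
  also have "\<dots> = var_x * (\<Sum>j\<le>K. scal (uc (n + 1) j) * var_s ^ j * var_x ^ (n + 1 - 2 * j))
      + scal (q ^ (n + 1)) * var_s * (\<Sum>i<K. scal (uc n i) * var_s ^ i * var_x ^ (n - 2 * i))"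
    unfolding sum.atMost_shift distrib_left sum_distrib_left term_0 add.assoc
      sum.distrib[symmetric]
    by (intro arg_cong2[where f = "(+)"] refl sum.cong) (simp_all only: lessThan_iff term_Suc)
  also have "\<dots> = var_x * inc_cheb_U (n + 1) k q
      + scal (q ^ (n + 1)) * var_s * inc_cheb_U n (k - 1) q"
    unfolding inc_cheb_U_def ranges uc_def ..
  finally show ?thesis .
qed

end
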